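(* For $k \ge 2$, let $G=K_{a_1, a_2, \ldots, a_k}$ be a complete $k$-partite graph of order $n=\sum_{i=1}^{k}a_i\geq 4$, and let $s$ be the number of partite sets of $G$ consisting of exactly one element. Then (a) $$\mathrm{cdim}(G)=\begin{cases} n-1 & \text{if } s=1 \text{ and } k=2,\\ \dim(G)=n-k & \text{if } s=0,\\ \dim(G)=n+s-k-1 & \text{otherwise};\end{cases}$$ (b) let $V(G)$ be partitioned into the partite sets $V_1, V_2, \ldots, V_k$ such that $|V_i|=a_i$, $1\leq i \leq k$, and $a_1 \le a_2 \le \ldots \le a_k$; then, for $v \in V(G)$, $$\mathrm{cdim}_G(v)=\begin{cases} \mathrm{cdim}(G)+1 & \text{if } s=1,\ k \ge 3, \text{ and } v \in V_1,\\ \mathrm{cdim}(G) & \text{otherwise}.\end{cases}$$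
   Context: A set $S\subseteq V(G)$ is a resolving set of a connected graph $G$ if for every pair of distinct vertices $x,y$ of $G$ there is $z\in S$ with $d(x,z)\ne d(y,z)$ ($d$ is the shortest-path distance); it is a connected resolving set if moreover the induced subgraph $G[S]$ is connected. $\dim(G)$ is the minimum cardinality of a resolving set of $G$, $\mathrm{cdim}(G)$ is the minimum cardinality of a connected resolving set of $G$, and $\mathrm{cdim}_G(v)$ is the minimum cardinality of a connected resolving set containing $v$. All partite sets are nonempty. *)

theory Defs
  imports "Graph_Theory.Graph_Theory" "HOL-Library.Disjoint_Sets"
begin

text \<open>
  Following Graph Theory, a finite simple undirected graph is a finite, symmetric, loop-free digraph
  without parallel arcs (locale \<open>graph\<close>).
\<close>

definition partite_sets :: "nat \<Rightarrow> (nat \<Rightarrow> 'a set) \<Rightarrow> ('a, 'b) pre_digraph \<Rightarrow> bool" where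
  "partite_sets k V G \<longleftrightarrow>
     verts G = (\<Union>i\<in>{1..k}. V i) \<and> disjoint_family_on V {1..k} \<and> (\<forall>i\<in>{1..k}. V i \<noteq> {}) \<and>
     arcs_ends G = {(u, v). \<exists>i\<in>{1..k}. \<exists>j\<in>{1..k}. i \<noteq> j \<and> u \<in> V i \<and> v \<in> V j}"

definition complete_multipartite :: "nat \<Rightarrow> (nat \<Rightarrow> nat) \<Rightarrow> ('a, 'b) pre_digraph \<Rightarrow> bool" where
  "complete_multipartite k a G \<longleftrightarrow>
     graph G \<and> (\<exists>V. partite_sets k V G \<and> (\<forall>i\<in>{1..k}. card (V i) = a i))"

text \<open>Shortest-path distance: the infimum of the walk costs when every arc costs 1.\<close>

definition gdist :: "('a, 'b) pre_digraph \<Rightarrow> 'a \<Rightarrow> 'a \<Rightarrow> ereal" where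
  "gdist G x y = wf_digraph.\<mu> G (\<lambda>_. 1) x y"

definition resolving_set :: "('a, 'b) pre_digraph \<Rightarrow> 'a set \<Rightarrow> bool" where
  "resolving_set G S \<longleftrightarrow> S \<subseteq> verts G \<and>
     (\<forall>x\<in>verts G. \<forall>y\<in>verts G. x \<noteq> y \<longrightarrow> (\<exists>z\<in>S. gdist G x z \<noteq> gdist G y z))"

text \<open>The qualified name avoids the topological notion of connectedness.\<close>

definition connected_resolving_set :: "('a, 'b) pre_digraph \<Rightarrow> 'a set \<Rightarrow> bool" where
  "connected_resolving_set G S \<longleftrightarrow>
     resolving_set G S \<and> Digraph_Component.connected (G \<restriction> S)"

definition metric_dim :: "('a, 'b) pre_digraph \<Rightarrow> nat" where
  "metric_dim G = (LEAST m. \<exists>S. resolving_set G S \<and> card S = m)"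

definition cdim :: "('a, 'b) pre_digraph \<Rightarrow> nat" where
  "cdim G = (LEAST m. \<exists>S. connected_resolving_set G S \<and> card S = m)"

definition cdim_at :: "('a, 'b) pre_digraph \<Rightarrow> 'a \<Rightarrow> nat" where
  "cdim_at G v = (LEAST m. \<exists>S. connected_resolving_set G S \<and> v \<in> S \<and> card S = m)"

end

theory Submission
  imports Defs
begin

text \<open>
  In a complete multipartite graph the distance between distinct vertices is 2 inside a part and 1
  across parts. Two vertices of one part can therefore be told apart only by one of the two, and
  vertices of two different parts only by a vertex of the union of these parts. So a set \<open>S\<close> of
  vertices resolves the graph if and only if it omits at most one vertex of each part and avoids at
  most one part entirely; an avoided part is then a singleton (\<open>resolving_set_iff\<close>).

  It is simplest to count the omitted vertices. Each of the \<open>k - s\<close> parts with at least two vertices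
  can give one of them, and at most one of the \<open>s\<close> singleton parts can. Hence, with \<open>c\<close> the number of
  singleton parts that \<open>S\<close> avoids, \<open>c \<le> 1\<close> and \<open>card S \<ge> n + s - k - c\<close> (\<open>resolving_card_ge\<close>).
  Equality is attained by omitting one vertex of every part with at least two and \<open>c\<close> singleton
  parts (\<open>obtain_tight_resolving_set\<close>). Such a choice can spare a prescribed vertex \<open>v\<close> unless \<open>v\<close>
  forms the avoided part.

  All the parameters are thus \<open>n + s - k - c\<close> for the largest possible \<open>c\<close>. For the metric dimension
  \<open>c = 1\<close> if a singleton part exists and \<open>c = 0\<close> otherwise. Connectedness costs nothing when \<open>S\<close>
  meets two parts, which is automatic if \<open>c + 2 \<le> k\<close>. This leaves \<open>k = 2\<close> with a singleton part:
  there avoiding that part would put all of the at least two vertices of \<open>S\<close> into one independent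
  set, so that \<open>c = 0\<close> is forced. Likewise, if \<open>{v}\<close> is the only singleton part, requiring \<open>v\<close> in
  \<open>S\<close> forces \<open>c = 0\<close>. For \<open>k \<ge> 3\<close> this costs one vertex more than without \<open>v\<close>, which is the
  exceptional case of the second claim.
\<close>

lemma Least_card_eqI:
  assumes "P S" and "\<And>S'. P S' \<Longrightarrow> card S \<le> card S'"
  shows "(LEAST m. \<exists>S. P S \<and> card S = m) = card S"
  by (rule Least_equality) (use assms in auto)

section \<open>Distances in complete multipartite graphs\<close>

lemma (in wf_digraph) gdist_eq_lengthI:
  assumes "awalk u p v" and "\<And>q. awalk u q v \<Longrightarrow> length p \<le> length q"
  shows "gdist G u v = ereal (real (length p))"
proof -
  have cost: "awalk_cost (\<lambda>_. 1) q = real (length q)" for q :: "'b list"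
    by (induction q) auto
  show ?thesis
    unfolding gdist_def \<mu>_def cost using assms by (intro antisym INF_lower2[of p] INF_greatest) auto
qed

text \<open>
  The partition is kept as a parameter, because the second claim speaks of an arbitrary partition,
  which may number the parts differently from the one that witnesses complete multipartiteness.
\<close>

locale complete_partition = graph G for G :: "('a, 'b) pre_digraph" +
  fixes k :: nat and V :: "nat \<Rightarrow> 'a set"
  assumes two_le_k: "2 \<le> k" and partite: "partite_sets k V G"
begin

lemma verts_eq: "verts G = (\<Union>i\<in>{1..k}. V i)"
  using partite by (simp add: partite_sets_def)

lemma part_nonempty: "i \<in> {1..k} \<Longrightarrow> V i \<noteq> {}"
  using partite by (simp add: partite_sets_def)

lemma part_unique: "\<lbrakk>i \<in> {1..k}; j \<in> {1..k}; v \<in> V i; v \<in> V j\<rbrakk> \<Longrightarrow> i = j"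
  using partite unfolding partite_sets_def disjoint_family_on_def by blast

lemma vertex_partE:
  assumes "v \<in> verts G"
  obtains i where "i \<in> {1..k}" "v \<in> V i"
  using assms by (auto simp: verts_eq)

lemma finite_part: "i \<in> {1..k} \<Longrightarrow> finite (V i)"
  using finite_verts by (auto simp: verts_eq)

lemma card_verts: "card (verts G) = (\<Sum>i=1..k. card (V i))"
  unfolding verts_eq using finite_part part_unique by (intro card_UN_disjoint) auto

lemma adjacent_iff:
  assumes "i \<in> {1..k}" "j \<in> {1..k}" "u \<in> V i" "v \<in> V j"
  shows "u \<rightarrow>\<^bsub>G\<^esub> v \<longleftrightarrow> i \<noteq> j"
proof -
  have "u \<rightarrow>\<^bsub>G\<^esub> v \<longleftrightarrow> (\<exists>i\<in>{1..k}. \<exists>j\<in>{1..k}. i \<noteq> j \<and> u \<in> V i \<and> v \<in> V j)"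
    using partite by (auto simp: partite_sets_def)
  then show ?thesis
    using assms part_unique by metis
qed

lemma gdist_parts:
  assumes i: "i \<in> {1..k}" "u \<in> V i" and j: "j \<in> {1..k}" "v \<in> V j"
  shows "gdist G u v = (if u = v then 0 else if i = j then 2 else 1)"
proof -
  have in_verts: "u \<in> verts G" "v \<in> verts G"
    using i j by (auto simp: verts_eq)
  have edge_walk: "\<exists>e. awalk x [e] y" if "x \<rightarrow>\<^bsub>G\<^esub> y" for x y
    using that by (metis arc_implies_awalk reachableE)
  have positive: "0 < length q" if "awalk u q v" "u \<noteq> v" for q
    using that by (cases q) (auto simp: awalk_simps)
  consider "u = v" | "u \<noteq> v" "i \<noteq> j" | "u \<noteq> v" "i = j"
    by blast
  then show ?thesis
  proof cases
    case 1
    then show ?thesis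
      using gdist_eq_lengthI[of u "[]" v] in_verts by (auto simp: awalk_simps zero_ereal_def)
  next
    case 2
    then obtain e where "awalk u [e] v"
      using edge_walk adjacent_iff i j by blast
    then have "gdist G u v = ereal (real (length [e]))"
      using positive 2 by (intro gdist_eq_lengthI) (auto simp: Suc_le_eq)
    then show ?thesis
      using 2 by (simp add: one_ereal_def)
  next
    case 3
    \<comment> \<open>A second part provides a common neighbour of \<open>u\<close> and \<open>v\<close>.\<close>
    define l where "l = (if i = 1 then 2 else 1 :: nat)"
    have l: "l \<in> {1..k}" "l \<noteq> i"
      using two_le_k by (auto simp: l_def)
    then obtain w where w: "w \<in> V l"
      using part_nonempty by blast
    obtain e f where "awalk u [e] w" "awalk w [f] v"
      using edge_walk adjacent_iff[of i l u w] adjacent_iff[of l j w v] i j l w 3 by metis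
    then have "awalk u ([e] @ [f]) v"
      by (rule awalk_appendI)
    moreover have "length ([e] @ [f]) \<le> length q" if q: "awalk u q v" for q
    proof (rule ccontr)
      assume "\<not> ?thesis"
      then have "length q < 2"
        by simp
      then have "length q = 1"
        using positive[OF q 3(1)] by linarith
      then obtain g where "q = [g]"
        by (auto simp: length_Suc_conv)
      then have "u \<rightarrow>\<^bsub>G\<^esub> v"
        using q by (auto simp: awalk_simps intro: in_arcs_imp_in_arcs_ends)
      then show False
        using adjacent_iff i j 3 by blast
    qed
    ultimately have "gdist G u v = ereal (real (length ([e] @ [f])))"
      by (rule gdist_eq_lengthI)
    then show ?thesis
      using 3 by simp
  qed
qed

section \<open>Resolving sets and the vertices they omit\<close>

text \<open>
  The distance from \<open>x\<close> to another vertex \<open>z\<close> only tells whether \<open>z\<close> lies in the part of \<open>x\<close>.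
  So a vertex \<open>z\<close> other than \<open>x\<close> and \<open>y\<close> cannot separate them if they share a part or if \<open>z\<close> lies
  in a third one. In all remaining cases the distances
  to \<open>z\<close> are different numbers among 0, 1 and 2.
\<close>

lemma resolving_set_iff:
  "resolving_set G S \<longleftrightarrow> S \<subseteq> verts G \<and>
     (\<forall>i\<in>{1..k}. \<forall>x\<in>V i - S. \<forall>y\<in>V i - S. x = y) \<and>
     (\<forall>i\<in>{1..k}. \<forall>j\<in>{1..k}. i \<noteq> j \<longrightarrow> S \<inter> V i \<noteq> {} \<or> S \<inter> V j \<noteq> {})"
  (is "_ \<longleftrightarrow> ?sub \<and> ?same \<and> ?diff")
proof (intro iffI conjI)
  assume S: "resolving_set G S"
  then show sub: ?sub
    by (simp add: resolving_set_def)
  have sep: "\<exists>z l. z \<in> S \<and> l \<in> {1..k} \<and> z \<in> V l \<and> gdist G x z \<noteq> gdist G y z"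
    if "i \<in> {1..k}" "j \<in> {1..k}" "x \<in> V i" "y \<in> V j" "x \<noteq> y" for i j x y
  proof -
    have "x \<in> verts G" "y \<in> verts G"
      using that(1-4) by (auto simp: verts_eq)
    then obtain z where "z \<in> S" "gdist G x z \<noteq> gdist G y z"
      using S \<open>x \<noteq> y\<close> unfolding resolving_set_def by blast
    moreover from this obtain l where "l \<in> {1..k}" "z \<in> V l"
      using sub vertex_partE by blast
    ultimately show ?thesis
      by blast
  qed
  show ?same
  proof (intro ballI, rule ccontr)
    fix i x y
    assume i: "i \<in> {1..k}" "x \<in> V i - S" "y \<in> V i - S" "x \<noteq> y"
    then obtain z l where z: "z \<in> S" "l \<in> {1..k}" "z \<in> V l" "gdist G x z \<noteq> gdist G y z"
      using sep[of i i x y] by blast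
    then have "z \<noteq> x" "z \<noteq> y"
      using i by auto
    then show False
      using z(4) gdist_parts[of i x l z] gdist_parts[of i y l z] i z by auto
  qed
  show ?diff
  proof (intro ballI impI, rule ccontr)
    fix i j
    assume ij: "i \<in> {1..k}" "j \<in> {1..k}" "i \<noteq> j" "\<not> (S \<inter> V i \<noteq> {} \<or> S \<inter> V j \<noteq> {})"
    obtain x y where xy: "x \<in> V i" "y \<in> V j"
      using part_nonempty[OF ij(1)] part_nonempty[OF ij(2)] by blast
    then have "x \<noteq> y"
      using ij(1-3) part_unique by blast
    then obtain z l where z: "z \<in> S" "l \<in> {1..k}" "z \<in> V l" "gdist G x z \<noteq> gdist G y z"
      using sep[of i j x y] ij xy by blast
    then have "z \<noteq> x" "z \<noteq> y" "l \<noteq> i" "l \<noteq> j"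
      using ij xy by auto
    then show False
      using z(4) gdist_parts[of i x l z] gdist_parts[of j y l z] ij xy z by auto
  qed
next
  assume R: "?sub \<and> ?same \<and> ?diff"
  have "\<exists>z\<in>S. gdist G x z \<noteq> gdist G y z" if x: "x \<in> verts G" and y: "y \<in> verts G" and "x \<noteq> y" for x y
  proof -
    obtain i j where i: "i \<in> {1..k}" "x \<in> V i" and j: "j \<in> {1..k}" "y \<in> V j"
      using x y vertex_partE by metis
    show ?thesis
    proof (cases "i = j")
      case True
      then have "x \<in> S \<or> y \<in> S"
        using R i j \<open>x \<noteq> y\<close> by blast
      moreover have "gdist G x x \<noteq> gdist G y x" "gdist G x y \<noteq> gdist G y y"
        using gdist_parts[OF i i] gdist_parts[OF j i] gdist_parts[OF i j] gdist_parts[OF j j] True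
          \<open>x \<noteq> y\<close> by auto
      ultimately show ?thesis
        by blast
    next
      case False
      then obtain z where z: "z \<in> S" "z \<in> V i \<or> z \<in> V j"
        using R i j by blast
      then have "gdist G x z \<noteq> gdist G y z"
        using False i j part_unique[of i j] gdist_parts[OF i i(1), of z] gdist_parts[OF j i(1), of z]
          gdist_parts[OF i j(1), of z] gdist_parts[OF j j(1), of z] by (auto split: if_splits)
      then show ?thesis
        using z by blast
    qed
  qed
  then show "resolving_set G S"
    using R by (auto simp: resolving_set_def)
qed

definition singles :: "nat set" where
  "singles = {i \<in> {1..k}. card (V i) = 1}"

text \<open>
  Since a resolving set omits at most one vertex of each part, the number of indices here is the
  number of omitted vertices. On a singleton part, being missed means being disjoint from \<open>S\<close>.
\<close>

definition missed :: "'a set \<Rightarrow> nat set" where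
  "missed S = {i \<in> {1..k}. \<not> V i \<subseteq> S}"

lemma singles_subset: "singles \<subseteq> {1..k}"
  by (auto simp: singles_def)

lemma index_sets_finite [simp]: "finite singles" "finite (missed S)"
  by (auto simp: singles_def missed_def)

lemma card_add_missed:
  assumes "S \<subseteq> verts G" and "\<And>i x y. \<lbrakk>i \<in> {1..k}; x \<in> V i - S; y \<in> V i - S\<rbrakk> \<Longrightarrow> x = y"
  shows "card S + card (missed S) = card (verts G)"
proof -
  have "card (V i - S) = 1" if i: "i \<in> missed S" for i
  proof -
    obtain x where "x \<in> V i - S"
      using i unfolding missed_def by blast
    then have "V i - S = {x}"
      using assms(2)[of i] i by (auto simp: missed_def)
    then show ?thesis
      by simp
  qed
  moreover have "verts G - S = (\<Union>i\<in>missed S. V i - S)"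
    by (auto simp: verts_eq missed_def)
  moreover have "card (\<Union>i\<in>missed S. V i - S) = (\<Sum>i\<in>missed S. card (V i - S))"
    using finite_part part_unique by (intro card_UN_disjoint) (auto simp: missed_def)
  ultimately have "card (verts G - S) = card (missed S)"
    by simp
  then show ?thesis
    using assms(1) finite_verts by (metis card_Diff_subset card_mono finite_subset le_add_diff_inverse)
qed

lemma singles_disjoint:
  assumes "i \<in> singles" "i \<in> missed S"
  shows "S \<inter> V i = {}"
proof -
  obtain x where "V i = {x}"
    using assms by (auto simp: singles_def card_1_singleton_iff)
  then show ?thesis
    using assms by (auto simp: missed_def)
qed

text \<open>
  A part with two or more vertices cannot be avoided, as at most one of its vertices is omitted.
\<close>

lemma resolving_meets_part:
  assumes "resolving_set G S" "i \<in> {1..k}" "i \<notin> missed S \<inter> singles"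
  shows "S \<inter> V i \<noteq> {}"
proof
  assume empty: "S \<inter> V i = {}"
  then have "V i - S = V i"
    by blast
  then have "\<forall>x\<in>V i. \<forall>y\<in>V i. x = y"
    using assms by (auto simp: resolving_set_iff)
  then have "\<exists>x. V i = {x}"
    using part_nonempty[OF assms(2)] by blast
  then have "i \<in> singles"
    using assms(2) by (auto simp: singles_def)
  moreover have "i \<in> missed S"
    using part_nonempty[OF assms(2)] empty assms(2) by (auto simp: missed_def)
  ultimately show False
    using assms(3) by blast
qed

lemma resolving_missed_singles:
  assumes "resolving_set G S"
  shows "card (missed S \<inter> singles) \<le> 1"
proof -
  have "i = j" if "i \<in> missed S \<inter> singles" "j \<in> missed S \<inter> singles" for i j
    using that assms singles_disjoint[of i S] singles_disjoint[of j S]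
    by (auto simp: resolving_set_iff missed_def)
  then show ?thesis
    by (auto simp: card_le_Suc0_iff_eq)
qed

text \<open>
  This is \<open>card S \<ge> n + s - k - c\<close>, with \<open>c\<close> the number of avoided singleton parts: the missed
  parts and the singleton parts overlap in \<open>c\<close> of the \<open>k\<close> indices. It is written with sums to avoid
  truncated subtraction.
\<close>

lemma resolving_card_ge:
  assumes "resolving_set G S"
  shows "card (verts G) + card singles \<le> card S + k + card (missed S \<inter> singles)"
proof -
  have "missed S \<union> singles \<subseteq> {1..k}"
    by (auto simp: missed_def singles_def)
  then have "card (missed S \<union> singles) \<le> k"
    using card_mono[of "{1..k}"] by fastforce
  then have "card (missed S) + card singles \<le> k + card (missed S \<inter> singles)"
    using card_Un_Int[of "missed S" singles] by simp
  moreover have "card S + card (missed S) = card (verts G)"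
    using assms by (intro card_add_missed) (auto simp: resolving_set_iff)
  ultimately show ?thesis
    by simp
qed

text \<open>
  Removing one vertex other than \<open>v\<close> from each part indexed by \<open>J\<close> leaves a resolving set as long as
  at most one part disappears. A replacement for \<open>v\<close> is missing only in the part \<open>{v}\<close>.
\<close>

lemma obtain_resolving_set:
  assumes J: "J \<subseteq> {1..k}" "card (J \<inter> singles) \<le> 1"
    and v: "v \<in> verts G" "\<And>i. i \<in> J \<inter> singles \<Longrightarrow> v \<notin> V i"
  obtains S where "resolving_set G S" "v \<in> S" "missed S = J"
proof -
  have "\<exists>x\<in>V i. x \<noteq> v" if "i \<in> J" for i
  proof (rule ccontr)
    assume "\<not> ?thesis"
    then have "V i \<subseteq> {v}"
      by blast
    then have "V i = {v}"
      using part_nonempty[of i] that J(1) by (blast dest: subset_singletonD)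
    then show False
      using v(2)[of i] that J(1) by (auto simp: singles_def)
  qed
  then obtain t where t: "\<And>i. i \<in> J \<Longrightarrow> t i \<in> V i" "\<And>i. i \<in> J \<Longrightarrow> t i \<noteq> v"
    by metis
  define S where "S = verts G - t ` J"
  have diff: "V i - S = (if i \<in> J then {t i} else {})" if "i \<in> {1..k}" for i
  proof -
    have "V i - S = V i \<inter> t ` J"
      using that by (auto simp: S_def verts_eq)
    moreover have "i = j" if "j \<in> J" "t j \<in> V i" for j
      using part_unique[OF \<open>i \<in> {1..k}\<close> _ that(2) t(1)] that(1) J(1) by blast
    ultimately show ?thesis
      using t(1) by auto
  qed
  have "i = j" if ij: "i \<in> {1..k}" "j \<in> {1..k}" "S \<inter> V i = {}" "S \<inter> V j = {}" for i j
  proof -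
    have single: "l \<in> J \<inter> singles" if "l \<in> {1..k}" "S \<inter> V l = {}" for l
    proof -
      have "V l - S = V l"
        using that by blast
      then have "l \<in> J" "V l = {t l}"
        using diff[OF that(1)] part_nonempty[OF that(1)] by (auto split: if_splits)
      then show ?thesis
        using that(1) by (simp add: singles_def)
    qed
    show ?thesis
      using J(2) single[OF ij(1,3)] single[OF ij(2,4)] finite_subset[OF J(1)]
      by (simp add: card_le_Suc0_iff_eq)
  qed
  then have "resolving_set G S"
    unfolding resolving_set_iff using diff by (auto simp: S_def)
  moreover have "v \<in> S"
    using v t by (auto simp: S_def)
  moreover have "missed S = J"
  proof -
    have "i \<in> missed S \<longleftrightarrow> i \<in> J" if "i \<in> {1..k}" for i
      using diff[OF that] that by (auto simp: missed_def split: if_splits)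
    moreover have "missed S \<subseteq> {1..k}"
      by (auto simp: missed_def)
    ultimately show ?thesis
      using J(1) by blast
  qed
  ultimately show thesis ..
qed

text \<open>
  Equality in \<open>resolving_card_ge\<close> means that every part with two or more vertices is missed, so \<open>J\<close>
  prescribes only the avoided singleton parts.
\<close>

lemma obtain_tight_resolving_set:
  assumes J: "J \<subseteq> singles" "card J \<le> 1"
    and v: "v \<in> verts G" "\<And>i. i \<in> J \<Longrightarrow> v \<notin> V i"
  obtains S where "resolving_set G S" "v \<in> S" "missed S \<inter> singles = J"
    "card S + k + card J = card (verts G) + card singles"
proof -
  let ?J = "({1..k} - singles) \<union> J"
  have int: "?J \<inter> singles = J"
    using J by blast
  then obtain S where S: "resolving_set G S" "v \<in> S" "missed S = ?J"
    using obtain_resolving_set[of ?J v] J v singles_subset by (metis Un_least Diff_subset order_trans)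
  have "missed S \<union> singles = {1..k}"
    using S(3) singles_subset J(1) by blast
  then have "card (missed S) + card singles = k + card J"
    using card_Un_Int[OF index_sets_finite(2,1), of S] int S(3) by simp
  moreover have "card S + card (missed S) = card (verts G)"
    using S(1) by (intro card_add_missed) (auto simp: resolving_set_iff)
  ultimately show thesis
    using that[OF S(1,2)] S(3) int by simp
qed

section \<open>Connectedness of induced subgraphs\<close>

lemma arcs_ends_induce: "arcs_ends (G \<restriction> S) = arcs_ends G \<inter> S \<times> S"
  by (auto simp: arcs_ends_conv)

text \<open>
  Vertices of different parts are adjacent, and two vertices of one part have a common neighbour
  in any other part that \<open>S\<close> meets.
\<close>

lemma connected_induce_if_two_parts:
  assumes S: "S \<subseteq> verts G" and ij: "i \<in> {1..k}" "j \<in> {1..k}" "i \<noteq> j"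
    and meets: "S \<inter> V i \<noteq> {}" "S \<inter> V j \<noteq> {}"
  shows "Digraph_Component.connected (G \<restriction> S)"
proof -
  let ?R = "rtrancl_on S ((arcs_ends (G \<restriction> S))\<^sup>s)"
  have edge: "(u, v) \<in> ?R" if "l \<in> {1..k}" "m \<in> {1..k}" "u \<in> S \<inter> V l" "v \<in> S \<inter> V m" "l \<noteq> m" for u v l m
  proof -
    have "(u, v) \<in> (arcs_ends (G \<restriction> S))\<^sup>s"
      using that adjacent_iff[of l m u v] by (auto simp: arcs_ends_induce symcl_def)
    then show ?thesis
      using that by (auto intro: rtrancl_on_into_rtrancl_on)
  qed
  have "(u, v) \<in> ?R" if u: "u \<in> S" and v: "v \<in> S" for u v
  proof -
    obtain l where l: "l \<in> {1..k}" "u \<in> S \<inter> V l"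
      using S u vertex_partE[of u] by blast
    obtain m where m: "m \<in> {1..k}" "v \<in> S \<inter> V m"
      using S v vertex_partE[of v] by blast
    show ?thesis
    proof (cases "l = m")
      case True
      obtain p w where w: "p \<in> {1..k}" "w \<in> S \<inter> V p" "p \<noteq> l"
        using ij meets by (cases "l = i") blast+
      then have "(u, w) \<in> ?R" "(w, v) \<in> ?R"
        using edge[of l p u w] edge[of p m w v] l m True by auto
      then show ?thesis
        by (rule rtrancl_on_trans)
    next
      case False
      then show ?thesis
        using edge l m by blast
    qed
  qed
  then show ?thesis
    using meets by (auto simp: connected_conv)
qed

lemma connected_induce_in_part:
  assumes "Digraph_Component.connected (G \<restriction> S)" "i \<in> {1..k}" "S \<subseteq> V i"
  shows "card S \<le> 1"
proof -
  have "arcs_ends (G \<restriction> S) = {}"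
    using adjacent_iff[of i i] assms(2,3) by (auto simp: arcs_ends_induce)
  then have "(u, v) \<in> rtrancl_on S {}" if "u \<in> S" "v \<in> S" for u v
    using assms(1) that by (auto simp: connected_conv symcl_def)
  then have "u = v" if "u \<in> S" "v \<in> S" for u v
    using that rtrancl_on_rtranclI[of u v S "{}"] by auto
  then show ?thesis
    using finite_subset[OF assms(3) finite_part[OF assms(2)]] by (auto simp: card_le_Suc0_iff_eq)
qed

text \<open>
  Only avoided singleton parts are disjoint from \<open>S\<close>, so at least two parts meet \<open>S\<close>.
\<close>

lemma connected_resolving_setI:
  assumes S: "resolving_set G S" and "card (missed S \<inter> singles) + 2 \<le> k"
  shows "connected_resolving_set G S"
proof -
  let ?I = "{1..k} - missed S \<inter> singles"
  have "2 \<le> card ?I"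
    using assms(2) by (subst card_Diff_subset) (auto simp: singles_def)
  then obtain i j where "i \<in> ?I" "j \<in> ?I" "i \<noteq> j"
    using card_le_Suc0_iff_eq[of ?I] by fastforce
  then show ?thesis
    using S connected_induce_if_two_parts[of S i j] resolving_meets_part[OF S]
    by (auto simp: connected_resolving_set_def resolving_set_def)
qed

section \<open>The dimensions in terms of the avoidable singleton parts\<close>

text \<open>
  The lower bound on the cardinality decreases in the number of avoided singleton parts, so a set that
  attains the bound and avoids as many of them as the property \<open>P\<close> allows is minimal.
\<close>

lemma Least_card_tight:
  assumes "P S" "card S + k + c = card (verts G) + card singles"
    and "\<And>S'. P S' \<Longrightarrow> resolving_set G S' \<and> card (missed S' \<inter> singles) \<le> c"
  shows "(LEAST m. \<exists>S. P S \<and> card S = m) = card (verts G) + card singles - k - c"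
proof -
  have "card S \<le> card S'" if "P S'" for S'
    using assms(2) assms(3)[OF that] resolving_card_ge[of S'] by linarith
  then have "(LEAST m. \<exists>S. P S \<and> card S = m) = card S"
    by (intro Least_card_eqI assms(1))
  then show ?thesis
    using assms(2) by simp
qed

lemma cdim_at_eq:
  assumes J: "J \<subseteq> singles" "card J \<le> 1" "card J + 2 \<le> k"
    and v: "v \<in> verts G" "\<And>i. i \<in> J \<Longrightarrow> v \<notin> V i"
    and bound: "\<And>S. \<lbrakk>connected_resolving_set G S; v \<in> S\<rbrakk> \<Longrightarrow> card (missed S \<inter> singles) \<le> card J"
  shows "cdim_at G v = card (verts G) + card singles - k - card J"
proof -
  obtain S where S: "resolving_set G S" "v \<in> S" "missed S \<inter> singles = J"
    "card S + k + card J = card (verts G) + card singles"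
    using obtain_tight_resolving_set[OF J(1,2) v] by blast
  show ?thesis
    unfolding cdim_at_def conj_assoc[symmetric]
    using S J(3) bound connected_resolving_setI[of S]
    by (intro Least_card_tight[of _ S]) (auto simp: connected_resolving_set_def)
qed

text \<open>
  Such a vertex lets the construction with a prescribed vertex serve the parameters that prescribe
  none.
\<close>

lemma obtain_vertex_avoiding:
  assumes J: "J \<subseteq> singles" "card J \<le> 1"
  obtains v where "v \<in> verts G" "\<And>i. i \<in> J \<Longrightarrow> v \<notin> V i"
proof -
  have "J \<subseteq> {1..k}"
    using J(1) singles_subset by blast
  moreover have "\<not> {1..k} \<subseteq> J"
    using J(2) two_le_k card_mono[of J "{1..k}"] finite_subset[OF J(1)] by auto
  ultimately obtain l where l: "l \<in> {1..k}" "l \<notin> J"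
    by blast
  then obtain v where v: "v \<in> V l"
    using part_nonempty by blast
  show thesis
  proof (rule that)
    show "v \<in> verts G"
      using v l(1) verts_eq by blast
    show "v \<notin> V i" if "i \<in> J" for i
      using part_unique[OF l(1) _ v] l(2) that \<open>J \<subseteq> {1..k}\<close> by blast
  qed
qed

lemma cdim_eq:
  assumes J: "J \<subseteq> singles" "card J \<le> 1" "card J + 2 \<le> k"
    and bound: "\<And>S. connected_resolving_set G S \<Longrightarrow> card (missed S \<inter> singles) \<le> card J"
  shows "cdim G = card (verts G) + card singles - k - card J"
proof -
  obtain v where v: "v \<in> verts G" "\<And>i. i \<in> J \<Longrightarrow> v \<notin> V i"
    using obtain_vertex_avoiding[OF J(1,2)] by blast
  obtain S where S: "resolving_set G S" "missed S \<inter> singles = J"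
    "card S + k + card J = card (verts G) + card singles"
    using obtain_tight_resolving_set[OF J(1,2) v] by blast
  show ?thesis
    unfolding cdim_def
    using S J(3) bound connected_resolving_setI[of S]
    by (intro Least_card_tight[of _ S]) (auto simp: connected_resolving_set_def)
qed

lemma metric_dim_eq:
  assumes J: "J \<subseteq> singles" "card J \<le> 1"
    and bound: "\<And>S. resolving_set G S \<Longrightarrow> card (missed S \<inter> singles) \<le> card J"
  shows "metric_dim G = card (verts G) + card singles - k - card J"
proof -
  obtain v where v: "v \<in> verts G" "\<And>i. i \<in> J \<Longrightarrow> v \<notin> V i"
    using obtain_vertex_avoiding[OF J(1,2)] by blast
  obtain S where S: "resolving_set G S"
    "card S + k + card J = card (verts G) + card singles"
    using obtain_tight_resolving_set[OF J(1,2) v] by blast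
  then show ?thesis
    unfolding metric_dim_def using bound by (intro Least_card_tight[of _ S]) auto
qed

text \<open>
  If a connected \<open>S\<close> avoided a singleton part, it would lie in the other part, which is independent,
  and have at most one vertex; but a resolving set has at least \<open>n - 2\<close> vertices.
\<close>

lemma two_parts_connected_meets_singles:
  assumes S: "connected_resolving_set G S"
    and "k = 2" "4 \<le> card (verts G)"
  shows "missed S \<inter> singles = {}"
proof (rule ccontr)
  assume "missed S \<inter> singles \<noteq> {}"
  then obtain j where j: "j \<in> missed S" "j \<in> singles"
    by blast
  \<comment> \<open>With indices 1 and 2, this is the index other than \<open>j\<close>.\<close>
  define l where "l = 3 - j"
  have "j \<in> {1..k}"
    using j(2) singles_subset by blast
  then have l: "l \<in> {1..k}" "{1..k} = {j, l}"
    using \<open>k = 2\<close> by (auto simp: l_def)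
  have res: "resolving_set G S" and conn: "Digraph_Component.connected (G \<restriction> S)"
    using S by (auto simp: connected_resolving_set_def)
  have "S \<subseteq> V j \<union> V l"
    using res l(2) verts_eq by (auto simp: resolving_set_def)
  then have "S \<subseteq> V l"
    using singles_disjoint j by blast
  then have "card S \<le> 1"
    using connected_induce_in_part conn l(1) by blast
  moreover have "1 \<le> card singles"
    using j(2) by (auto simp: Suc_le_eq card_gt_0_iff)
  then have "card (verts G) + 1 \<le> card S + 2 + 1"
    using resolving_card_ge[OF res] resolving_missed_singles[OF res] \<open>k = 2\<close> by linarith
  ultimately show False
    using assms(3) by linarith
qed

lemma k_le_card_verts: "k \<le> card (verts G)"
proof -
  have "(\<Sum>i=1..k. 1) \<le> (\<Sum>i=1..k. card (V i))"
    using part_nonempty finite_part by (intro sum_mono) (auto simp: Suc_le_eq card_gt_0_iff)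
  then show ?thesis
    using card_verts by simp
qed

lemma metric_dim_formula:
  "metric_dim G = card (verts G) + card singles - k - (if singles = {} then 0 else 1)"
proof (cases "singles = {}")
  case True
  then show ?thesis
    using metric_dim_eq[of "{}"] by simp
next
  case False
  then obtain j where "j \<in> singles"
    by blast
  then show ?thesis
    using metric_dim_eq[of "{j}"] resolving_missed_singles by auto
qed

lemma connected_meets_singles:
  assumes "connected_resolving_set G S" "4 \<le> card (verts G)" "\<not> (3 \<le> k \<and> singles \<noteq> {})"
  shows "missed S \<inter> singles = {}"
proof (cases "singles = {}")
  case False
  then have "k = 2"
    using assms(3) two_le_k by simp
  then show ?thesis
    using two_parts_connected_meets_singles assms(1,2) by blast
qed simp

lemma cdim_formula:
  assumes "4 \<le> card (verts G)"
  shows "cdim G = card (verts G) + card singles - k - (if 3 \<le> k \<and> singles \<noteq> {} then 1 else 0)"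
proof (cases "3 \<le> k \<and> singles \<noteq> {}")
  case True
  then obtain j where "j \<in> singles"
    by blast
  then show ?thesis
    using True cdim_eq[of "{j}"] resolving_missed_singles by (auto simp: connected_resolving_set_def)
next
  case False
  then show ?thesis
    using cdim_eq[of "{}"] two_le_k connected_meets_singles assms by auto
qed

lemma cdim_at_formula:
  assumes "4 \<le> card (verts G)" "v \<in> verts G"
  shows "cdim_at G v = card (verts G) + card singles - k -
           (if 3 \<le> k \<and> (\<exists>j\<in>singles. v \<notin> V j) then 1 else 0)"
proof (cases "3 \<le> k \<and> (\<exists>j\<in>singles. v \<notin> V j)")
  case True
  then obtain j where "j \<in> singles" "v \<notin> V j"
    by blast
  then show ?thesis
    using True cdim_at_eq[of "{j}" v] resolving_missed_singles assms(2)
    by (auto simp: connected_resolving_set_def)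
next
  case False
  \<comment> \<open>If \<open>v\<close> lies in every singleton part, a set containing \<open>v\<close> meets all of them.\<close>
  have "missed S \<inter> singles = {}" if S: "connected_resolving_set G S" "v \<in> S" for S
  proof (cases "3 \<le> k \<and> singles \<noteq> {}")
    case True
    then have "\<forall>j\<in>singles. S \<inter> V j \<noteq> {}"
      using False S(2) by blast
    then show ?thesis
      using singles_disjoint by blast
  qed (use connected_meets_singles S assms(1) in blast)
  then show ?thesis
    using False cdim_at_eq[of "{}" v] two_le_k assms(2) by auto
qed

lemma two_parts_not_both_single:
  assumes "k = 2" "3 \<le> card (verts G)"
  shows "card singles \<le> 1"
proof -
  have "{1..k} = {1, 2}"
    using assms(1) by auto
  then have sub: "singles \<subseteq> {1, 2}" and "card (verts G) = card (V 1) + card (V 2)"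
    using card_verts singles_subset by auto
  then have "card (V 1) \<noteq> 1 \<or> card (V 2) \<noteq> 1"
    using assms(2) by linarith
  then have "1 \<notin> singles \<or> 2 \<notin> singles"
    by (simp add: singles_def)
  then have "singles \<subset> {1, 2}"
    using sub by blast
  then show ?thesis
    using psubset_card_mono[of "{1, 2}" singles] by simp
qed

end

section \<open>The dimensions in terms of the part sizes\<close>

theorem proposition5p16:
  fixes G :: "('a, 'b) pre_digraph" and a :: "nat \<Rightarrow> nat" and k n s :: nat
  assumes "k \<ge> 2"
    and "complete_multipartite k a G"
    and "n = (\<Sum>i=1..k. a i)"
    and "n \<ge> 4"
    and "s = card {i\<in>{1..k}. a i = 1}"
  shows "(if s = 1 \<and> k = 2 then cdim G = n - 1
          else if s = 0 then cdim G = metric_dim G \<and> metric_dim G = n - k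
          else cdim G = metric_dim G \<and> metric_dim G = n + s - k - 1)
       \<and> (\<forall>V. partite_sets k V G \<and> (\<forall>i\<in>{1..k}. card (V i) = a i) \<and> mono_on {1..k} a \<longrightarrow>
            (\<forall>v\<in>verts G. cdim_at G v =
               (if s = 1 \<and> k \<ge> 3 \<and> v \<in> V 1 then cdim G + 1 else cdim G)))"
proof -
  from assms(2) obtain V where "graph G" and V: "partite_sets k V G" "\<forall>i\<in>{1..k}. card (V i) = a i"
    by (auto simp: complete_multipartite_def)
  have partition: "complete_partition G k W" if "partite_sets k W G" for W
    using \<open>graph G\<close> \<open>k \<ge> 2\<close> that
    by (simp add: complete_partition_def complete_partition_axioms_def)
  have sizes: "card (verts G) = n" "card (complete_partition.singles k W) = s"
    "complete_partition.singles k W = {i\<in>{1..k}. a i = 1}"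
    if W: "partite_sets k W G" "\<forall>i\<in>{1..k}. card (W i) = a i" for W
  proof -
    interpret complete_partition G k W
      by (rule partition) (rule W)
    show "card (verts G) = n"
      using card_verts W(2) assms(3) by simp
    show "singles = {i\<in>{1..k}. a i = 1}"
      using W(2) by (auto simp: singles_def)
    then show "card singles = s"
      using assms(5) by simp
  qed
  interpret complete_partition G k V
    by (rule partition) (rule V)
  note n = sizes(1)[OF V] and s = sizes(2)[OF V]
  have no_single: "singles = {} \<longleftrightarrow> s = 0"
    using s index_sets_finite(1) by auto
  have cdim: "cdim G = n + s - k - (if 3 \<le> k \<and> s \<noteq> 0 then 1 else 0)"
    using cdim_formula \<open>4 \<le> n\<close> n s no_single by simp
  have dim: "metric_dim G = n + s - k - (if s = 0 then 0 else 1)"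
    using metric_dim_formula n s no_single by simp
  have "s \<le> 1" if "k = 2"
    using two_parts_not_both_single[OF that] n s \<open>4 \<le> n\<close> by simp
  then have "if s = 1 \<and> k = 2 then cdim G = n - 1
          else if s = 0 then cdim G = metric_dim G \<and> metric_dim G = n - k
          else cdim G = metric_dim G \<and> metric_dim G = n + s - k - 1"
    using cdim dim \<open>2 \<le> k\<close> by (cases "k = 2") auto
  moreover have "cdim_at G v = (if s = 1 \<and> k \<ge> 3 \<and> v \<in> W 1 then cdim G + 1 else cdim G)"
    if W: "partite_sets k W G" "\<forall>i\<in>{1..k}. card (W i) = a i"
      and mono: "mono_on {1..k} a" and v: "v \<in> verts G" for W v
  proof -
    interpret W: complete_partition G k W
      by (rule partition) (rule W)
    have at: "cdim_at G v = n + s - k - (if 3 \<le> k \<and> (\<exists>j\<in>W.singles. v \<notin> W j) then 1 else 0)"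
      using W.cdim_at_formula[OF _ v] sizes[OF W] \<open>4 \<le> n\<close> by simp
    have "(\<exists>j\<in>W.singles. v \<notin> W j) \<longleftrightarrow> s \<noteq> 0 \<and> \<not> (s = 1 \<and> v \<in> W 1)"
    proof (cases "s = 1")
      case True
      then obtain j where j: "W.singles = {j}"
        using sizes(2)[OF W] by (auto simp: card_1_singleton_iff)
      then have "j \<in> {1..k}" "a j = 1"
        using sizes(3)[OF W] by auto
      \<comment> \<open>The sizes increase, so the only singleton part is the first one.\<close>
      then have "a 1 \<le> 1"
        using mono \<open>2 \<le> k\<close> by (auto dest: mono_onD[of _ _ 1 j])
      moreover have "a 1 \<noteq> 0"
        using W(2) W.part_nonempty[of 1] W.finite_part[of 1] \<open>2 \<le> k\<close> by force
      ultimately have "1 \<in> W.singles"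
        using sizes(3)[OF W] \<open>2 \<le> k\<close> by simp
      then show ?thesis
        using j True by simp
    next
      case False
      show ?thesis
      proof (cases "s = 0")
        case True
        then show ?thesis
          using sizes(2)[OF W] by simp
      next
        case nonzero: False
        then have "\<not> card W.singles \<le> Suc 0"
          using False sizes(2)[OF W] by simp
        then obtain i j where ij: "i \<in> W.singles" "j \<in> W.singles" "i \<noteq> j"
          by (auto simp: card_le_Suc0_iff_eq)
        then have "v \<notin> W i \<or> v \<notin> W j"
          using W.part_unique[of i j v] by (auto simp: W.singles_def)
        then show ?thesis
          using ij nonzero False by blast
      qed
    qed
    \<comment> \<open>The truncated differences \<open>n + 1 - k\<close> and \<open>n + 1 - k - 1\<close> differ by 1 because \<open>k \<le> n\<close>.\<close>
    then show ?thesis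
      using at cdim k_le_card_verts n by auto
  qed
  ultimately show ?thesis
    by blast
qed

end
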